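(* Let $\epsilon\in\big(0,\tfrac12(\sqrt6-2)\big)$ (so that $\tfrac12-2\epsilon-\epsilon^2>0$). Consider the two-stage inventory problem described in the context with $y_1=10-\epsilon$, $\rho=1$, $$\mathcal I_1=[1-\epsilon,3+\epsilon],\ \mu_1=2,\ \sigma_1=1,\ c_1=0,\ b_1=2,\ h_1=2;\qquad \mathcal I_2=\mathbb R_+,\ \mu_2=8,\ \sigma_2=3,\ c_2=0,\ b_2=1,\ h_2=1.$$ Let $\Pi_s^{opt}$ be the set of all optimal policies of the multistage-static problem. Then any admissible policy $\tilde\pi=(\tilde x_1,\tilde x_2)\in\Pi$ satisfying $\tilde x_1=y_1$ and $\tilde x_2(d_1)=y_1-d_1+\epsilon$ (as a function of the first-stage demand $d_1$) belongs to $\Pi_s^{opt}$, and the corresponding optimal value equals $19-2\epsilon$. Moreover, no base-stock policy belongs to $\Pi_s^{opt}$.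
   Context: Two-stage setting ($T=2$). $\rho\in(0,1]$ is a discount factor, $y_1\in\mathbb R$ a given initial inventory level. For $t=1,2$: $c_t,b_t,h_t\ge 0$ are ordering, backorder and holding costs; $\mathcal I_t\subseteq\mathbb R_+$ is a closed interval; $\mathcal M_t$ is the set of probability measures $Q_t$ on $\mathbb R$ with support in $\mathcal I_t$, $\mathbb E_{Q_t}[D_t]=\mu_t$, $\mathbb E_{Q_t}[D_t^2]=\mu_t^2+\sigma_t^2$. Let $\mathcal M=\{Q_1\times Q_2: Q_1\in\mathcal M_1,\ Q_2\in\mathcal M_2\}$ (product measures for $(D_1,D_2)$). Write $[a]_+=\max\{a,0\}$. Policies. $\Pi$ is the set of admissible policies $\pi=(x_1,x_2)$, where $x_1\in\mathbb R$ is a constant with $x_1\ge y_1$ and $x_2:\mathbb R_+\to\mathbb R$ is a measurable function of the first-stage demand $d_1$ with $x_2(d_1)\ge y_2(d_1):=x_1-d_1$ for all $d_1\in\mathbb R_+$. A policy is a base-stock policy if there exist constants $x_1^*,x_2^*\in\mathbb R$ such that $x_1=\max\{y_1,x_1^*\}$ and $x_2(d_1)=\max\{y_2(d_1),x_2^*\}$ for all $d_1\in\mathbb R_+$. Costs. $\Psi_t(x,d)=b_t[d-x]_++h_t[x-d]_+$ and $$Z^\pi(D_1,D_2)=c_1(x_1-y_1)+\Psi_1(x_1,D_1)+\rho\big[c_2(x_2(D_1)-y_2(D_1))+\Psi_2(x_2(D_1),D_2)\big].$$ Multistage-static problem: $\inf_{\pi\in\Pi}\sup_{Q\in\mathcal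 M}\mathbb E_Q[Z^\pi]$; $\pi$ is optimal if it attains the infimum, which is the optimal value. *)

theory Defs
  imports "HOL-Probability.Probability"
begin

record stage =
  order_cost :: real
  backorder_cost :: real
  holding_cost :: real
  demand_range :: "real set"
  demand_mean :: real
  demand_sd :: real

record inventory_problem =
  initial_level :: real
  discount :: real
  stage1 :: stage
  stage2 :: stage

text \<open>For a closed range, the support of \<open>Q\<close> is contained in it iff it has full measure.\<close>

definition marginal_laws :: "stage \<Rightarrow> real measure set" where
  "marginal_laws s = {Q. prob_space Q \<and> sets Q = sets borel \<and>
     (AE d in Q. d \<in> demand_range s) \<and>
     integrable Q (\<lambda>d. d) \<and> (\<integral>d. d \<partial>Q) = demand_mean s \<and>
     integrable Q (\<lambda>d. d\<^sup>2) \<and> (\<integral>d. d\<^sup>2 \<partial>Q) = (demand_mean s)\<^sup>2 + (demand_sd s)\<^sup>2}"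

definition demand_laws :: "inventory_problem \<Rightarrow> (real \<times> real) measure set" where
  "demand_laws P = {Q1 \<Otimes>\<^sub>M Q2 | Q1 Q2. Q1 \<in> marginal_laws (stage1 P) \<and> Q2 \<in> marginal_laws (stage2 P)}"

text \<open>
  The second-stage order-up-to level is a function of the first-stage demand on the nonnegative
  reals. As demand ranges consist of nonnegative reals, its values at negative arguments are irrelevant.
\<close>

type_synonym policy = "real \<times> (real \<Rightarrow> real)"

definition admissible :: "inventory_problem \<Rightarrow> policy set" where
  "admissible P = {(x1, x2). x1 \<ge> initial_level P \<and>
     x2 \<in> borel_measurable (restrict_space borel {0..}) \<and>
     (\<forall>d1\<ge>0. x2 d1 \<ge> x1 - d1)}"

definition base_stock :: "inventory_problem \<Rightarrow> policy set" where
  "base_stock P = {(x1, x2). \<exists>s1 s2. x1 = max (initial_level P) s1 \<and>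
     (\<forall>d1\<ge>0. x2 d1 = max (x1 - d1) s2)}"

definition mismatch_cost :: "stage \<Rightarrow> real \<Rightarrow> real \<Rightarrow> real" where
  "mismatch_cost s x d = backorder_cost s * max (d - x) 0 + holding_cost s * max (x - d) 0"

fun total_cost :: "inventory_problem \<Rightarrow> policy \<Rightarrow> real \<times> real \<Rightarrow> real" where
  "total_cost P (x1, x2) (d1, d2) =
     order_cost (stage1 P) * (x1 - initial_level P) + mismatch_cost (stage1 P) x1 d1 +
     discount P * (order_cost (stage2 P) * (x2 d1 - (x1 - d1)) + mismatch_cost (stage2 P) (x2 d1) d2)"

lemma total_cost_nonneg:
  assumes "(x1, x2) \<in> admissible P" and "d1 \<ge> 0" and "discount P \<ge> 0"
    and "\<forall>s\<in>{stage1 P, stage2 P}. order_cost s \<ge> 0 \<and> backorder_cost s \<ge> 0 \<and> holding_cost s \<ge> 0"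
  shows "total_cost P (x1, x2) (d1, d2) \<ge> 0"
  using assms by (auto simp: admissible_def mismatch_cost_def intro!: add_nonneg_nonneg mult_nonneg_nonneg)

text \<open>
  The expected cost may be infinite, since an admissible \<open>x2\<close> need not be integrable.
  The cost of an admissible policy is nonnegative (lemma \<open>total_cost_nonneg\<close>), so the nonnegative
  integral is its expectation as an extended real.
\<close>

definition worst_case_cost :: "inventory_problem \<Rightarrow> policy \<Rightarrow> ennreal" where
  "worst_case_cost P \<pi> = (SUP Q\<in>demand_laws P. \<integral>\<^sup>+ d. ennreal (total_cost P \<pi> d) \<partial>Q)"

definition optimal_value :: "inventory_problem \<Rightarrow> ennreal" where
  "optimal_value P = (INF \<pi>\<in>admissible P. worst_case_cost P \<pi>)"

definition optimal_policies :: "inventory_problem \<Rightarrow> policy set" where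
  "optimal_policies P = {\<pi> \<in> admissible P. worst_case_cost P \<pi> = optimal_value P}"

end

theory Submission
  imports Defs
begin

text \<open>
  Write \<open>D1 = 2 + U\<close> and \<open>D2 = 8 + V\<close>. Since \<open>D1 \<le> x1\<close>, the first stage costs \<open>2 (x1 - 2)\<close> on
  average. For \<open>x2 d = 10 - d\<close> the second stage costs \<open>\<bar>U + V\<bar>\<close>. For every fixed \<open>v\<close> one has
  \<open>E \<bar>U + v\<bar> \<le> (v\<^sup>2 + 9) / 6\<close>, because either the sign of \<open>U + v\<close> is constant or \<open>v\<^sup>2 \<le> 3\<close>; averaging
  over \<open>V\<close> gives at most 3. Conversely, if \<open>m\<close> is the mean of \<open>x2 D1 - 8\<close>, the law of \<open>V\<close> on the
  two points \<open>m \<plusminus> sqrt (9 + m\<^sup>2)\<close> forces a second-stage cost of at least \<open>sqrt (9 + m\<^sup>2)\<close>, and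
  \<open>V = \<plusminus>3\<close> forces at least 3. A base-stock policy with \<open>x1 = y1\<close> cannot make \<open>m\<close> vanish for two
  different laws of \<open>U\<close>.
\<close>

section \<open>Two-point demand laws\<close>

text \<open>Mass \<open>p\<close> at \<open>a\<close> and \<open>1 - p\<close> at \<open>b\<close>,
  pushed forward to \<open>borel\<close> because \<open>marginal_laws\<close> asks for that
  sigma-algebra.\<close>

definition two_point :: "real \<Rightarrow> real \<Rightarrow> real \<Rightarrow> real measure" where
  "two_point p a b = distr (measure_pmf (bernoulli_pmf p)) borel (\<lambda>t. if t then a else b)"

lemma sets_two_point [simp, measurable_cong]: "sets (two_point p a b) = sets borel"
  by (simp add: two_point_def)

lemma prob_space_two_point: "prob_space (two_point p a b)"
  unfolding two_point_def by (rule measure_pmf.prob_space_distr) simp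

lemma nn_integral_two_point:
  assumes "p \<in> {0..1}" "f \<in> borel_measurable borel"
  shows "(\<integral>\<^sup>+ x. f x \<partial>two_point p a b) = ennreal p * f a + ennreal (1 - p) * f b"
  using assms by (simp add: two_point_def nn_integral_distr mult.commute)

lemma ennreal_convex_combination:
  assumes "p \<in> {0..1}" "0 \<le> u" "0 \<le> v"
  shows "ennreal p * ennreal u + ennreal (1 - p) * ennreal v = ennreal (p * u + (1 - p) * v)"
  using assms by (simp add: ennreal_mult)

lemma
  fixes f :: "real \<Rightarrow> real"
  assumes "p \<in> {0..1}" "f \<in> borel_measurable borel"
  shows integral_two_point: "(\<integral>x. f x \<partial>two_point p a b) = p * f a + (1 - p) * f b"
    and integrable_two_point: "integrable (two_point p a b) f"
  using assms
  by (auto simp: two_point_def integral_distr integrable_distr_eq integrable_measure_pmf_finite)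

lemma AE_two_point:
  assumes "{x. R x} \<in> sets borel" "R a" "R b"
  shows "AE x in two_point p a b. R x"
  unfolding two_point_def by (subst AE_distr_iff) (use assms in auto)

lemma two_point_in_marginal_laws:
  assumes "p \<in> {0..1}" "demand_range s \<in> sets borel" "a \<in> demand_range s" "b \<in> demand_range s"
    and "p * a + (1 - p) * b = demand_mean s"
    and "p * a\<^sup>2 + (1 - p) * b\<^sup>2 = (demand_mean s)\<^sup>2 + (demand_sd s)\<^sup>2"
  shows "two_point p a b \<in> marginal_laws s"
  using assms
  by (auto simp: marginal_laws_def prob_space_two_point integral_two_point integrable_two_point
      intro!: AE_two_point)

section \<open>Moment constraints and quadratic majorants\<close>

lemma
  assumes "Q \<in> marginal_laws s"
  shows integrable_marginal_law_quadratic: "integrable Q (\<lambda>d. k0 + k1 * d + k2 * d\<^sup>2)"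
    and integral_marginal_law_quadratic: "(\<integral>d. k0 + k1 * d + k2 * d\<^sup>2 \<partial>Q) =
      k0 + k1 * demand_mean s + k2 * ((demand_mean s)\<^sup>2 + (demand_sd s)\<^sup>2)"
proof -
  interpret prob_space Q using assms by (simp add: marginal_laws_def)
  have i: "integrable Q (\<lambda>d. d)" "integrable Q (\<lambda>d. d\<^sup>2)"
    using assms by (auto simp: marginal_laws_def)
  show "integrable Q (\<lambda>d. k0 + k1 * d + k2 * d\<^sup>2)" using i by simp
  show "(\<integral>d. k0 + k1 * d + k2 * d\<^sup>2 \<partial>Q) =
      k0 + k1 * demand_mean s + k2 * ((demand_mean s)\<^sup>2 + (demand_sd s)\<^sup>2)"
    using assms i by (simp add: marginal_laws_def prob_space)
qed

text \<open>Weak duality for the moment problem: all laws of a stage give a quadratic the same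
  integral, so a quadratic majorant on the demand range bounds the expectation uniformly.\<close>

lemma nn_integral_le_marginal_law_quadratic:
  assumes Q: "Q \<in> marginal_laws s"
    and f: "\<And>d. d \<in> demand_range s \<Longrightarrow> 0 \<le> f d \<and> f d \<le> k0 + k1 * d + k2 * d\<^sup>2"
  shows "(\<integral>\<^sup>+ d. ennreal (f d) \<partial>Q) \<le>
    ennreal (k0 + k1 * demand_mean s + k2 * ((demand_mean s)\<^sup>2 + (demand_sd s)\<^sup>2))"
proof -
  have AE: "AE d in Q. d \<in> demand_range s" using Q by (simp add: marginal_laws_def)
  have "(\<integral>\<^sup>+ d. ennreal (f d) \<partial>Q) \<le> (\<integral>\<^sup>+ d. ennreal (k0 + k1 * d + k2 * d\<^sup>2) \<partial>Q)"
    by (rule nn_integral_mono_AE) (use AE f in \<open>auto elim!: eventually_mono intro!: ennreal_leI\<close>)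
  also have "\<dots> = ennreal (\<integral>d. k0 + k1 * d + k2 * d\<^sup>2 \<partial>Q)"
  proof (rule nn_integral_eq_integral)
    show "integrable Q (\<lambda>d. k0 + k1 * d + k2 * d\<^sup>2)"
      by (rule integrable_marginal_law_quadratic[OF Q])
    show "AE d in Q. 0 \<le> k0 + k1 * d + k2 * d\<^sup>2"
      using AE by eventually_elim (use f order_trans in blast)
  qed
  finally show ?thesis by (simp add: integral_marginal_law_quadratic[OF Q])
qed

section \<open>Expected cost as an iterated integral\<close>

text \<open>
  The cost need not be measurable at negative first-stage demands; clamping the argument of the
  second-stage policy repairs this without changing the integral.
\<close>

lemma total_cost_clamp_measurable:
  assumes "x2 \<in> borel_measurable (restrict_space borel {0..})"
  shows "total_cost P (x1, \<lambda>d. x2 (max d 0)) \<in> borel_measurable (borel \<Otimes>\<^sub>M borel)"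
proof -
  have "(\<lambda>d::real. max d 0) \<in> measurable borel (restrict_space borel {0..})"
    by (rule measurable_restrict_space2) auto
  then have [measurable]: "(\<lambda>d::real. x2 (max d 0)) \<in> borel_measurable borel"
    using assms by (rule measurable_compose)
  have "total_cost P (x1, \<lambda>d. x2 (max d 0)) = (\<lambda>(d1, d2).
     order_cost (stage1 P) * (x1 - initial_level P) + mismatch_cost (stage1 P) x1 d1 +
     discount P * (order_cost (stage2 P) * (x2 (max d1 0) - (x1 - d1)) +
       mismatch_cost (stage2 P) (x2 (max d1 0)) d2))"
    by auto
  also have "\<dots> \<in> borel_measurable (borel \<Otimes>\<^sub>M borel)"
    unfolding mismatch_cost_def by measurable
  finally show ?thesis .
qed

text \<open>The lower bound integrates the second demand first; the upper bound integrates the first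
  demand first, with \<open>d2\<close> frozen.\<close>

lemma nn_integral_total_cost:
  assumes Q1: "Q1 \<in> marginal_laws (stage1 P)" and Q2: "Q2 \<in> marginal_laws (stage2 P)"
    and rng: "demand_range (stage1 P) \<subseteq> {0..}"
    and x2: "x2 \<in> borel_measurable (restrict_space borel {0..})"
  shows "(\<integral>\<^sup>+ d. ennreal (total_cost P (x1, x2) d) \<partial>(Q1 \<Otimes>\<^sub>M Q2)) =
      (\<integral>\<^sup>+ d1. \<integral>\<^sup>+ d2. ennreal (total_cost P (x1, \<lambda>d. x2 (max d 0)) (d1, d2)) \<partial>Q2 \<partial>Q1)"
    and "(\<integral>\<^sup>+ d. ennreal (total_cost P (x1, x2) d) \<partial>(Q1 \<Otimes>\<^sub>M Q2)) =
      (\<integral>\<^sup>+ d2. \<integral>\<^sup>+ d1. ennreal (total_cost P (x1, \<lambda>d. x2 (max d 0)) (d1, d2)) \<partial>Q1 \<partial>Q2)"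
proof -
  interpret Q1: prob_space Q1 using Q1 by (simp add: marginal_laws_def)
  interpret Q2: prob_space Q2 using Q2 by (simp add: marginal_laws_def)
  interpret pair_sigma_finite Q1 Q2 ..
  have [measurable_cong]: "sets Q1 = sets borel" "sets Q2 = sets borel"
    using Q1 Q2 by (auto simp: marginal_laws_def)
  let ?f = "\<lambda>d. ennreal (total_cost P (x1, \<lambda>d. x2 (max d 0)) d)"
  note [measurable] = total_cost_clamp_measurable[OF x2]
  have "AE d1 in Q1. 0 \<le> d1"
    using Q1 rng by (auto simp: marginal_laws_def elim!: eventually_mono)
  then have "AE d in Q1 \<Otimes>\<^sub>M Q2. 0 \<le> fst d"
    by (intro AE_pair_measure) auto
  then have eq: "(\<integral>\<^sup>+ d. ennreal (total_cost P (x1, x2) d) \<partial>(Q1 \<Otimes>\<^sub>M Q2)) = integral\<^sup>N (Q1 \<Otimes>\<^sub>M Q2) ?f"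
    by (intro nn_integral_cong_AE) (auto elim!: eventually_mono)
  show "(\<integral>\<^sup>+ d. ennreal (total_cost P (x1, x2) d) \<partial>(Q1 \<Otimes>\<^sub>M Q2)) =
      (\<integral>\<^sup>+ d1. \<integral>\<^sup>+ d2. ?f (d1, d2) \<partial>Q2 \<partial>Q1)"
    unfolding eq by (rule Q2.nn_integral_fst[symmetric]) measurable
  show "(\<integral>\<^sup>+ d. ennreal (total_cost P (x1, x2) d) \<partial>(Q1 \<Otimes>\<^sub>M Q2)) =
      (\<integral>\<^sup>+ d2. \<integral>\<^sup>+ d1. ?f (d1, d2) \<partial>Q1 \<partial>Q2)"
    unfolding eq by (rule nn_integral_snd[symmetric]) measurable
qed

section \<open>The concrete problem\<close>

definition example_problem :: "real \<Rightarrow> inventory_problem" where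
  "example_problem \<epsilon> = \<lparr>initial_level = 10 - \<epsilon>, discount = 1,
      stage1 = \<lparr>order_cost = 0, backorder_cost = 2, holding_cost = 2,
        demand_range = {1 - \<epsilon>..3 + \<epsilon>}, demand_mean = 2, demand_sd = 1\<rparr>,
      stage2 = \<lparr>order_cost = 0, backorder_cost = 1, holding_cost = 1,
        demand_range = {0..}, demand_mean = 8, demand_sd = 3\<rparr>\<rparr>"

lemma total_cost_example:
  "total_cost (example_problem \<epsilon>) (x1, x2) (d1, d2) = 2 * \<bar>x1 - d1\<bar> + \<bar>x2 d1 - d2\<bar>"
  by (auto simp: example_problem_def mismatch_cost_def max_def)

section \<open>Lower bounds from two-point laws\<close>

text \<open>The weight \<open>p\<close> gives the law on \<open>m + r\<close> and
  \<open>m - r\<close> mean 0. Each absolute value is bounded below by the linear branch valid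
  between the atoms. The result is affine in \<open>x\<close>, so averaging over the first demand
  involves only the mean of \<open>x2\<close>.\<close>

lemma two_point_deviation_bound:
  fixes m r x :: real
  assumes "r > 0" "\<bar>m\<bar> \<le> r" "p = (1 - m / r) / 2"
  shows "p \<in> {0..1}"
    and "r - m / r * (m - x) \<le> p * \<bar>x - (m + r)\<bar> + (1 - p) * \<bar>x - (m - r)\<bar>"
proof -
  have "m / r \<le> 1" "- 1 \<le> m / r" using assms(1,2) by (auto simp: field_simps)
  then show p: "p \<in> {0..1}" unfolding assms(3) by auto
  have "p * (m + r - x) + (1 - p) * (x - (m - r)) \<le> p * \<bar>x - (m + r)\<bar> + (1 - p) * \<bar>x - (m - r)\<bar>"
    using p by (intro add_mono mult_left_mono) auto
  moreover have "p * (m + r - x) + (1 - p) * (x - (m - r)) = r + (2 * p - 1) * (m - x)"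
    by (simp add: algebra_simps)
  moreover have "2 * p - 1 = - (m / r)" using assms(3) by simp
  ultimately show "r - m / r * (m - x) \<le> p * \<bar>x - (m + r)\<bar> + (1 - p) * \<bar>x - (m - r)\<bar>" by simp
qed

context
  fixes \<epsilon> :: real
  assumes eps_pos: "0 < \<epsilon>" and eps_small: "2 * \<epsilon> + \<epsilon>\<^sup>2 < 1 / 2"
begin

lemma eps_lt: "\<epsilon> < 1 / 4"
  using eps_small zero_le_power2[of \<epsilon>] by linarith

text \<open>Tests the policy against a product of two-point laws. The parameter \<open>m\<close> is
  free: \<open>m = 0\<close> removes the influence of \<open>x2\<close>, while \<open>m\<close>
  equal to the mean of \<open>x2 - 8\<close> makes the correction term vanish.\<close>

lemma worst_case_cost_ge:
  assumes adm: "(x1, x2) \<in> admissible (example_problem \<epsilon>)"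
    and q: "q \<in> {0..1}" and ab: "a \<in> {1 - \<epsilon>..3 + \<epsilon>}" "b \<in> {1 - \<epsilon>..3 + \<epsilon>}"
    and mean: "q * a + (1 - q) * b = 2" and sq: "q * a\<^sup>2 + (1 - q) * b\<^sup>2 = 5"
    and m: "- 3 \<le> m"
  shows "ennreal (2 * (x1 - 2) + sqrt (9 + m\<^sup>2) - m / sqrt (9 + m\<^sup>2) * (m - (q * x2 a + (1 - q) * x2 b - 8)))
    \<le> worst_case_cost (example_problem \<epsilon>) (x1, x2)"
proof -
  let ?P = "example_problem \<epsilon>"
  define r where "r = sqrt (9 + m\<^sup>2)"
  define p where "p = (1 - m / r) / 2"
  have r0: "r > 0" unfolding r_def by (simp add: add_pos_nonneg)
  have r2: "r\<^sup>2 = 9 + m\<^sup>2" unfolding r_def by simp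
  have mr: "\<bar>m\<bar> \<le> r" unfolding r_def by (rule real_le_rsqrt) simp
  \<comment> \<open>The lower atom \<open>8 + m - r\<close> has to be a nonnegative demand; after
    squaring this reads \<open>-55 \<le> 16 * m\<close>.\<close>
  have r8: "r \<le> 8 + m" unfolding r_def
    by (rule real_le_lsqrt) (use m in \<open>auto simp: power2_eq_square algebra_simps\<close>)
  note dev = two_point_deviation_bound[OF r0 mr p_def]
  have p: "p \<in> {0..1}" by (rule dev(1))
  have pr: "(2 * p - 1) * r = - m" using r0 by (simp add: p_def field_simps)
  have "p * (m + r)\<^sup>2 + (1 - p) * (m - r)\<^sup>2 = m\<^sup>2 + r\<^sup>2 + 2 * m * ((2 * p - 1) * r)"
    by (simp add: power2_eq_square algebra_simps)
  then have var: "p * (m + r)\<^sup>2 + (1 - p) * (m - r)\<^sup>2 = 9"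
    unfolding pr r2 by (simp add: power2_eq_square)
  have mean2: "p * (m + r) + (1 - p) * (m - r) = 0"
    using pr by (simp add: algebra_simps)
  define Q1 where "Q1 = two_point q a b"
  define Q2 where "Q2 = two_point p (8 + m + r) (8 + m - r)"
  have Q1: "Q1 \<in> marginal_laws (stage1 ?P)"
    unfolding Q1_def by (rule two_point_in_marginal_laws)
      (use q ab mean sq in \<open>simp_all add: example_problem_def\<close>)
  have Q2: "Q2 \<in> marginal_laws (stage2 ?P)"
  proof -
    have "p * (8 + m + r) + (1 - p) * (8 + m - r) = 8 + (p * (m + r) + (1 - p) * (m - r))"
      by (simp add: algebra_simps)
    moreover have "p * (8 + m + r)\<^sup>2 + (1 - p) * (8 + m - r)\<^sup>2 =
        64 + 16 * (p * (m + r) + (1 - p) * (m - r)) + (p * (m + r)\<^sup>2 + (1 - p) * (m - r)\<^sup>2)"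
      by (simp add: power2_eq_square algebra_simps)
    ultimately show ?thesis unfolding Q2_def mean2 var
      by (intro two_point_in_marginal_laws)
        (use p r0 r8 in \<open>simp_all add: example_problem_def\<close>)
  qed
  have x2: "x2 \<in> borel_measurable (restrict_space borel {0..})"
    using adm by (simp add: admissible_def)
  have x1: "x1 \<ge> 10 - \<epsilon>" using adm by (simp add: admissible_def example_problem_def)
  let ?z = "\<lambda>d. x2 (max d 0)"
  let ?f = "\<lambda>d1 d2. ennreal (total_cost ?P (x1, ?z) (d1, d2))"
  have M: "total_cost ?P (x1, ?z) \<in> borel_measurable (borel \<Otimes>\<^sub>M borel)"
    by (rule total_cost_clamp_measurable[OF x2])
  note [measurable] = M
  have inner: "(\<integral>\<^sup>+ d2. ?f d1 d2 \<partial>Q2) =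
     ennreal p * ?f d1 (8 + m + r) + ennreal (1 - p) * ?f d1 (8 + m - r)" for d1
    unfolding Q2_def by (rule nn_integral_two_point[OF p]) measurable
  define g where "g d1 = p * total_cost ?P (x1, ?z) (d1, 8 + m + r)
    + (1 - p) * total_cost ?P (x1, ?z) (d1, 8 + m - r)" for d1
  have inner': "(\<integral>\<^sup>+ d2. ?f d1 d2 \<partial>Q2) = ennreal (g d1)" for d1
    unfolding inner g_def unfolding total_cost_example using p
    by (intro ennreal_convex_combination) auto
  have g0: "g d \<ge> 0" for d
    unfolding g_def total_cost_example using p by (intro add_nonneg_nonneg mult_nonneg_nonneg) auto
  have gm: "g \<in> borel_measurable borel" unfolding g_def by measurable
  have gge: "2 * (x1 - d) + (r - m / r * (m - (x2 d - 8))) \<le> g d" if "d \<in> {1 - \<epsilon>..3 + \<epsilon>}" for d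
  proof -
    \<comment> \<open>Even the largest demand \<open>3 + \<epsilon>\<close> stays below
      \<open>10 - \<epsilon>\<close>, so the first stage incurs only holding cost, linear in
      \<open>d\<close>.\<close>
    have d: "0 \<le> d" "d \<le> x1" using that x1 eps_lt by auto
    have "g d = 2 * (x1 - d) + (p * \<bar>(x2 d - 8) - (m + r)\<bar> + (1 - p) * \<bar>(x2 d - 8) - (m - r)\<bar>)"
      using d unfolding g_def total_cost_example by (simp add: algebra_simps)
    then show ?thesis using dev(2)[of "x2 d - 8"] by simp
  qed
  have "(\<integral>\<^sup>+ d. ennreal (total_cost ?P (x1, x2) d) \<partial>(Q1 \<Otimes>\<^sub>M Q2)) = (\<integral>\<^sup>+ d1. ennreal (g d1) \<partial>Q1)"
    using eps_lt inner'
    by (subst nn_integral_total_cost(1)[OF Q1 Q2 _ x2]) (auto simp: example_problem_def)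
  also have "\<dots> = ennreal q * ennreal (g a) + ennreal (1 - q) * ennreal (g b)"
    unfolding Q1_def by (rule nn_integral_two_point[OF q]) (use gm in measurable)
  also have "\<dots> = ennreal (q * g a + (1 - q) * g b)"
    by (rule ennreal_convex_combination[OF q g0 g0])
  finally have eq: "(\<integral>\<^sup>+ d. ennreal (total_cost ?P (x1, x2) d) \<partial>(Q1 \<Otimes>\<^sub>M Q2)) = \<dots>" .
  let ?k = "m / r"
  have "q * (2 * (x1 - a) + (r - ?k * (m - (x2 a - 8)))) + (1 - q) * (2 * (x1 - b) + (r - ?k * (m - (x2 b - 8))))
      \<le> q * g a + (1 - q) * g b"
    using q ab by (intro add_mono mult_left_mono gge) auto
  \<comment> \<open>A variable \<open>k\<close> in place of \<open>m / r\<close> keeps the identity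
    polynomial.\<close>
  moreover have "q * (2 * (x1 - a) + (r - k * (m - (x2 a - 8)))) + (1 - q) * (2 * (x1 - b) + (r - k * (m - (x2 b - 8))))
      = 2 * (x1 - (q * a + (1 - q) * b)) + r - k * (m - (q * x2 a + (1 - q) * x2 b - 8))" for k
    by (simp add: algebra_simps)
  ultimately have "ennreal (2 * (x1 - 2) + r - ?k * (m - (q * x2 a + (1 - q) * x2 b - 8)))
      \<le> (\<integral>\<^sup>+ d. ennreal (total_cost ?P (x1, x2) d) \<partial>(Q1 \<Otimes>\<^sub>M Q2))"
    unfolding eq by (intro ennreal_leI) (simp only: mean)
  also have "\<dots> \<le> worst_case_cost ?P (x1, x2)"
    unfolding worst_case_cost_def by (rule SUP_upper) (use Q1 Q2 in \<open>auto simp: demand_laws_def\<close>)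
  finally show ?thesis unfolding r_def .
qed

text \<open>Fair laws on 1, 3 and on 5, 11: the first stage costs \<open>2 * (x1 - 2)\<close> and
  the second at least 3, whatever \<open>x2\<close> is.\<close>

lemma worst_case_cost_ge_static:
  assumes "(x1, x2) \<in> admissible (example_problem \<epsilon>)"
  shows "ennreal (2 * x1 - 1) \<le> worst_case_cost (example_problem \<epsilon>) (x1, x2)"
  using worst_case_cost_ge[OF assms, of "1/2" 3 1 0] eps_pos by simp

section \<open>Upper bound for the candidate policy\<close>

text \<open>For \<open>u\<close> of mean 0 and variance 1 the majorant has expectation
  \<open>k0 + k2\<close>. The parabola \<open>(v\<^sup>2 + 9) / 6\<close> touches the absolute value
  at 3 and -3 and has mean 3 when \<open>v\<close> has mean 0 and variance 9.\<close>

lemma mean_abs_sum_majorant: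
  fixes v :: real
  obtains k0 k1 k2 where "\<And>u. \<bar>u\<bar> \<le> 1 + \<epsilon> \<Longrightarrow> \<bar>u + v\<bar> \<le> k0 + k1 * u + k2 * u\<^sup>2"
    and "k0 + k2 \<le> (v\<^sup>2 + 9) / 6"
proof -
  have sq: "\<bar>v\<bar> \<le> (v\<^sup>2 + 9) / 6"
    using zero_le_power2[of "\<bar>v\<bar> - 3"] by (simp add: power2_diff)
  consider "v \<ge> 1 + \<epsilon>" | "v \<le> - (1 + \<epsilon>)" | "\<bar>v\<bar> \<le> 1 + \<epsilon>" by linarith
  then show thesis
  proof cases
    case 1
    then show thesis using that[of v 1 0] sq by simp
  next
    case 2
    then show thesis using that[of "- v" "-1" 0] sq by simp
  next
    case 3
    then have "v\<^sup>2 \<le> (1 + \<epsilon>)\<^sup>2" by (metis abs_ge_zero power2_abs power_mono)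
    then have v: "v\<^sup>2 \<le> 3" using eps_small by (simp add: power2_sum)
    \<comment> \<open>AM-GM: \<open>\<bar>u + v\<bar> \<le> ((u + v)\<^sup>2 + 4) / 4\<close>\<close>
    have "\<bar>u + v\<bar> \<le> (v\<^sup>2 / 4 + 1) + v / 2 * u + 1 / 4 * u\<^sup>2" for u
      using zero_le_power2[of "\<bar>u + v\<bar> - 2"] by (simp add: power2_diff power2_sum algebra_simps)
    \<comment> \<open>Here \<open>k0 + k2\<close> is \<open>v\<^sup>2 / 4 + 5 / 4\<close>, which is
      at most \<open>(v\<^sup>2 + 9) / 6\<close> exactly when
      \<open>v\<^sup>2 \<le> 3\<close>.\<close>
    then show thesis using that[of "v\<^sup>2 / 4 + 1" "v / 2" "1 / 4"] v by simp
  qed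
qed

lemma worst_case_cost_le:
  assumes adm: "(10 - \<epsilon>, x2) \<in> admissible (example_problem \<epsilon>)"
    and x2_eq: "\<And>d. d \<ge> 0 \<Longrightarrow> x2 d = 10 - d"
  shows "worst_case_cost (example_problem \<epsilon>) (10 - \<epsilon>, x2) \<le> ennreal (19 - 2 * \<epsilon>)"
  unfolding worst_case_cost_def
proof (rule SUP_least)
  let ?P = "example_problem \<epsilon>"
  let ?z = "\<lambda>d. x2 (max d 0)"
  fix Q assume "Q \<in> demand_laws ?P"
  then obtain Q1 Q2 where Q: "Q = Q1 \<Otimes>\<^sub>M Q2"
    and Q1: "Q1 \<in> marginal_laws (stage1 ?P)" and Q2: "Q2 \<in> marginal_laws (stage2 ?P)"
    by (auto simp: demand_laws_def)
  have x2: "x2 \<in> borel_measurable (restrict_space borel {0..})"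
    using adm by (simp add: admissible_def)
  have inner: "(\<integral>\<^sup>+ d1. ennreal (total_cost ?P (10 - \<epsilon>, ?z) (d1, d2)) \<partial>Q1)
      \<le> ennreal (16 - 2 * \<epsilon> + ((d2 - 8)\<^sup>2 + 9) / 6)" for d2
  proof -
    obtain k0 k1 k2 where k: "\<And>u. \<bar>u\<bar> \<le> 1 + \<epsilon> \<Longrightarrow> \<bar>u + (d2 - 8)\<bar> \<le> k0 + k1 * u + k2 * u\<^sup>2"
      and k02: "k0 + k2 \<le> ((d2 - 8)\<^sup>2 + 9) / 6"
      using mean_abs_sum_majorant[of "d2 - 8"] by blast
    \<comment> \<open>Holding cost plus majorant at \<open>u = d - 2\<close>, expanded in powers of
      \<open>d\<close>; the coefficient of the square is \<open>k2\<close>.\<close>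
    let ?c0 = "20 - 2 * \<epsilon> + k0 - 2 * k1 + 4 * k2" and ?c1 = "k1 - 4 * k2 - 2"
    have "(\<integral>\<^sup>+ d1. ennreal (total_cost ?P (10 - \<epsilon>, ?z) (d1, d2)) \<partial>Q1) \<le>
      ennreal (?c0 + ?c1 * demand_mean (stage1 ?P) +
        k2 * ((demand_mean (stage1 ?P))\<^sup>2 + (demand_sd (stage1 ?P))\<^sup>2))"
    proof (rule nn_integral_le_marginal_law_quadratic[OF Q1])
      fix d assume "d \<in> demand_range (stage1 ?P)"
      then have d: "1 - \<epsilon> \<le> d" "d \<le> 3 + \<epsilon>" by (auto simp: example_problem_def)
      have "total_cost ?P (10 - \<epsilon>, ?z) (d, d2) = 2 * (10 - \<epsilon> - d) + \<bar>(d - 2) + (d2 - 8)\<bar>"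
        using d eps_lt unfolding total_cost_example by (simp add: x2_eq)
      also have "\<dots> \<le> 2 * (10 - \<epsilon> - d) + (k0 + k1 * (d - 2) + k2 * (d - 2)\<^sup>2)"
        using k[of "d - 2"] d by simp
      also have "\<dots> = ?c0 + ?c1 * d + k2 * d\<^sup>2"
        by (simp add: power2_eq_square algebra_simps)
      finally show "0 \<le> total_cost ?P (10 - \<epsilon>, ?z) (d, d2) \<and>
          total_cost ?P (10 - \<epsilon>, ?z) (d, d2) \<le> ?c0 + ?c1 * d + k2 * d\<^sup>2"
        unfolding total_cost_example by simp
    qed
    \<comment> \<open>With first moment 2 and second moment 5 the value is
      \<open>16 - 2 * \<epsilon> + k0 + k2\<close>.\<close>
    also have "\<dots> \<le> ennreal (16 - 2 * \<epsilon> + ((d2 - 8)\<^sup>2 + 9) / 6)"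
      using k02 by (intro ennreal_leI) (simp add: example_problem_def)
    finally show ?thesis .
  qed
  have "(\<integral>\<^sup>+ d. ennreal (total_cost ?P (10 - \<epsilon>, x2) d) \<partial>Q) =
      (\<integral>\<^sup>+ d2. \<integral>\<^sup>+ d1. ennreal (total_cost ?P (10 - \<epsilon>, ?z) (d1, d2)) \<partial>Q1 \<partial>Q2)"
    unfolding Q using eps_lt
    by (intro nn_integral_total_cost(2)[OF Q1 Q2 _ x2]) (auto simp: example_problem_def)
  also have "\<dots> \<le> (\<integral>\<^sup>+ d2. ennreal (16 - 2 * \<epsilon> + ((d2 - 8)\<^sup>2 + 9) / 6) \<partial>Q2)"
    by (intro nn_integral_mono inner)
  \<comment> \<open>The coefficients expand \<open>((d - 8)\<^sup>2 + 9) / 6\<close>; its mean under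
    variance 9 is 3.\<close>
  also have "\<dots> \<le> ennreal ((16 - 2 * \<epsilon> + 73 / 6) + (- 8 / 3) * demand_mean (stage2 ?P) +
        1 / 6 * ((demand_mean (stage2 ?P))\<^sup>2 + (demand_sd (stage2 ?P))\<^sup>2))"
  proof (rule nn_integral_le_marginal_law_quadratic[OF Q2])
    fix d :: real
    have "0 \<le> 16 - 2 * \<epsilon> + ((d - 8)\<^sup>2 + 9) / 6" using eps_lt by simp
    then show "0 \<le> 16 - 2 * \<epsilon> + ((d - 8)\<^sup>2 + 9) / 6 \<and> 16 - 2 * \<epsilon> + ((d - 8)\<^sup>2 + 9) / 6
        \<le> (16 - 2 * \<epsilon> + 73 / 6) + (- 8 / 3) * d + 1 / 6 * d\<^sup>2"
      by (simp add: power2_diff field_simps)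
  qed
  also have "\<dots> = ennreal (19 - 2 * \<epsilon>)" by (simp add: example_problem_def)
  finally show "(\<integral>\<^sup>+ d. ennreal (total_cost ?P (10 - \<epsilon>, x2) d) \<partial>Q) \<le> ennreal (19 - 2 * \<epsilon>)" .
qed

section \<open>Optimal value and optimality condition\<close>

text \<open>The static bound \<open>2 * x1 - 1\<close> increases with \<open>x1\<close>, which
  admissibility keeps at or above \<open>10 - \<epsilon>\<close>.\<close>

lemma worst_case_cost_ge_optimum:
  assumes "\<pi> \<in> admissible (example_problem \<epsilon>)"
  shows "ennreal (19 - 2 * \<epsilon>) \<le> worst_case_cost (example_problem \<epsilon>) \<pi>"
proof -
  obtain x1 x2 where \<pi>: "\<pi> = (x1, x2)" by fastforce
  have "x1 \<ge> 10 - \<epsilon>" using assms unfolding \<pi> by (simp add: admissible_def example_problem_def)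
  then have "ennreal (19 - 2 * \<epsilon>) \<le> ennreal (2 * x1 - 1)" by (intro ennreal_leI) simp
  also have "\<dots> \<le> worst_case_cost (example_problem \<epsilon>) \<pi>"
    using worst_case_cost_ge_static assms unfolding \<pi> by blast
  finally show ?thesis .
qed

lemma optimal_value_example: "optimal_value (example_problem \<epsilon>) = ennreal (19 - 2 * \<epsilon>)"
  unfolding optimal_value_def
proof (rule antisym)
  let ?\<pi> = "(10 - \<epsilon>, \<lambda>d::real. 10 - d)"
  have adm: "?\<pi> \<in> admissible (example_problem \<epsilon>)"
    using eps_pos by (auto simp: admissible_def example_problem_def intro!: measurable_restrict_space1)
  then show "(INF \<pi>\<in>admissible (example_problem \<epsilon>). worst_case_cost (example_problem \<epsilon>) \<pi>)
      \<le> ennreal (19 - 2 * \<epsilon>)"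
    by (rule INF_lower2) (rule worst_case_cost_le[OF adm], simp)
qed (auto intro!: INF_greatest worst_case_cost_ge_optimum)

text \<open>A nonzero deviation \<open>m\<close> of the mean from 8 would raise the second-stage
  cost to \<open>sqrt (9 + m\<^sup>2)\<close>, above the optimal 3.\<close>

lemma optimal_policy_mean:
  assumes opt: "(10 - \<epsilon>, x2) \<in> optimal_policies (example_problem \<epsilon>)"
    and q: "q \<in> {0..1}" and ab: "a \<in> {1 - \<epsilon>..3 + \<epsilon>}" "b \<in> {1 - \<epsilon>..3 + \<epsilon>}"
    and mean: "q * a + (1 - q) * b = 2" and sq: "q * a\<^sup>2 + (1 - q) * b\<^sup>2 = 5"
  shows "q * x2 a + (1 - q) * x2 b = 8"
proof (rule ccontr)
  assume neq: "q * x2 a + (1 - q) * x2 b \<noteq> 8"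
  define m where "m = q * x2 a + (1 - q) * x2 b - 8"
  have adm: "(10 - \<epsilon>, x2) \<in> admissible (example_problem \<epsilon>)"
    and cost: "worst_case_cost (example_problem \<epsilon>) (10 - \<epsilon>, x2) = ennreal (19 - 2 * \<epsilon>)"
    using opt optimal_value_example by (auto simp: optimal_policies_def)
  have x2_ge: "x2 d \<ge> 10 - \<epsilon> - d" if "d \<in> {1 - \<epsilon>..3 + \<epsilon>}" for d
    using adm that eps_lt by (auto simp: admissible_def)
  \<comment> \<open>Averaging the admissibility bound gives \<open>-\<epsilon> \<le> m\<close>,
    hence the range of \<open>m\<close> that the lower bound requires.\<close>
  have "q * (10 - \<epsilon> - a) + (1 - q) * (10 - \<epsilon> - b) \<le> q * x2 a + (1 - q) * x2 b"
    using q ab by (intro add_mono mult_left_mono x2_ge) auto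
  moreover have "q * (10 - \<epsilon> - a) + (1 - q) * (10 - \<epsilon> - b) = 10 - \<epsilon> - (q * a + (1 - q) * b)"
    by (simp add: algebra_simps)
  ultimately have "- 3 \<le> m" using mean eps_lt by (simp add: m_def)
  from worst_case_cost_ge[OF adm q ab mean sq this]
  have "ennreal (16 - 2 * \<epsilon> + sqrt (9 + m\<^sup>2)) \<le> ennreal (19 - 2 * \<epsilon>)"
    by (simp add: cost flip: m_def)
  then have "16 - 2 * \<epsilon> + sqrt (9 + m\<^sup>2) \<le> 19 - 2 * \<epsilon>"
    using eps_lt by (subst (asm) ennreal_le_iff) auto
  then have "sqrt (9 + m\<^sup>2) \<le> 3" by simp
  moreover have "sqrt (9 + m\<^sup>2) > 3"
    using neq by (intro real_less_rsqrt) (simp add: m_def)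
  ultimately show False by simp
qed

section \<open>Base-stock policies\<close>

text \<open>Optimality forces \<open>x1 = 10 - \<epsilon>\<close>. The mean condition for the fair
  law on 1 and 3 then fixes the second base-stock level, and an extremal skewed law violates the
  condition at that level.\<close>

lemma base_stock_not_optimal:
  assumes bs: "(x1, x2) \<in> base_stock (example_problem \<epsilon>)"
  shows "(x1, x2) \<notin> optimal_policies (example_problem \<epsilon>)"
proof
  assume opt: "(x1, x2) \<in> optimal_policies (example_problem \<epsilon>)"
  then have adm: "(x1, x2) \<in> admissible (example_problem \<epsilon>)"
    and cost: "worst_case_cost (example_problem \<epsilon>) (x1, x2) = ennreal (19 - 2 * \<epsilon>)"
    using optimal_value_example by (auto simp: optimal_policies_def)
  have "ennreal (2 * x1 - 1) \<le> ennreal (19 - 2 * \<epsilon>)"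
    using worst_case_cost_ge_static[OF adm] cost by simp
  then have "x1 \<le> 10 - \<epsilon>" using eps_lt by (simp add: ennreal_le_iff)
  moreover have "x1 \<ge> 10 - \<epsilon>" using adm by (simp add: admissible_def example_problem_def)
  ultimately have x1: "x1 = 10 - \<epsilon>" by simp
  obtain s where s: "\<And>d. d \<ge> 0 \<Longrightarrow> x2 d = max (10 - \<epsilon> - d) s"
    using bs unfolding base_stock_def x1 by auto
  note mean = optimal_policy_mean[OF opt[unfolded x1]]
  have "1/2 * x2 3 + (1 - 1/2) * x2 1 = 8"
    using eps_pos by (intro mean) auto
  \<comment> \<open>A level up to \<open>7 - \<epsilon>\<close> gives a mean below 8, and one above
    \<open>9 - \<epsilon>\<close> gives a mean above 8. In between,
    \<open>(9 - \<epsilon>) + s = 16\<close>.\<close>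
  then have s_eq: "s = 7 + \<epsilon>"
    using s[of 3] s[of 1] eps_pos eps_lt by (auto simp: max_def field_simps split: if_splits)
  \<comment> \<open>The two-point law with mean 2, variance 1 and upper atom at the end
    \<open>3 + \<epsilon>\<close> of the range: atoms \<open>2 + A\<close> and
    \<open>2 - 1 / A\<close>, with mass \<open>q\<close> on the former.\<close>
  define A where "A = 1 + \<epsilon>"
  define q where "q = 1 / (1 + A\<^sup>2)"
  have A: "1 < A" "A\<^sup>2 < 2" using eps_pos eps_small by (auto simp: A_def power2_sum)
  have A1: "1 + A\<^sup>2 > 0" by (simp add: add_pos_nonneg)
  have q: "q \<in> {0..1}" "q > 0" "1 - q = q * A\<^sup>2" using A1 by (auto simp: q_def field_simps)
  have invA: "0 < 1 / A" "1 / A < 1" "A\<^sup>2 * (1 / A) = A" "A\<^sup>2 * (1 / A)\<^sup>2 = 1"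
    using A by (auto simp: power2_eq_square)
  have qA: "q + q * A\<^sup>2 = 1" using q(3) by simp
  have "q * x2 (2 + A) + (1 - q) * x2 (2 - 1 / A) = 8"
  proof (rule mean[OF q(1)])
    show "2 + A \<in> {1 - \<epsilon>..3 + \<epsilon>}" "2 - 1 / A \<in> {1 - \<epsilon>..3 + \<epsilon>}"
      using A(1) invA(1,2) eps_pos unfolding A_def atLeastAtMost_iff by linarith+
    have "q * (2 + A) + q * A\<^sup>2 * (2 - 1 / A) = 2 * (q + q * A\<^sup>2) + q * (A - A\<^sup>2 * (1 / A))"
      by (simp add: algebra_simps)
    then show "q * (2 + A) + (1 - q) * (2 - 1 / A) = 2" unfolding q(3) invA qA by simp
    have "q * (2 + A)\<^sup>2 + q * A\<^sup>2 * (2 - 1 / A)\<^sup>2 = 4 * (q + q * A\<^sup>2)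
        + 4 * q * (A - A\<^sup>2 * (1 / A)) + q * (A\<^sup>2 + A\<^sup>2 * (1 / A)\<^sup>2)"
      by (simp add: power2_diff power2_sum algebra_simps)
    also have "\<dots> = 5" unfolding invA qA using qA by (simp add: algebra_simps)
    finally show "q * (2 + A)\<^sup>2 + (1 - q) * (2 - 1 / A)\<^sup>2 = 5" unfolding q(3) .
  qed
  \<comment> \<open>At the upper atom the base-stock level exceeds the remaining inventory
    \<open>7 - 2 * \<epsilon>\<close>; at the lower atom the remaining inventory bounds
    \<open>x2\<close> from below.\<close>
  moreover have "x2 (2 + A) = 7 + \<epsilon>"
    using s[of "2 + A"] A eps_pos by (simp add: s_eq A_def)
  moreover have "x2 (2 - 1 / A) \<ge> 8 - \<epsilon> + 1 / A"
    using s[of "2 - 1 / A"] invA by simp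
  ultimately have "q * (7 + \<epsilon>) + q * A\<^sup>2 * (8 - \<epsilon> + 1 / A) \<le> 8"
    using q by (metis add_left_mono atLeastAtMost_iff diff_ge_0_iff_ge mult_left_mono)
  moreover have "q * (7 + \<epsilon>) + q * A\<^sup>2 * (8 - \<epsilon> + 1 / A)
      = 8 * (q + q * A\<^sup>2) + q * (\<epsilon> - 1 + A\<^sup>2 * (1 / A) - \<epsilon> * A\<^sup>2)"
    by (simp add: algebra_simps)
  \<comment> \<open>Since \<open>A - 1 = \<epsilon>\<close>, the excess of the mean over 8 is at
    least this product, positive because \<open>A\<^sup>2 < 2\<close>.\<close>
  ultimately have "q * (\<epsilon> * (2 - A\<^sup>2)) \<le> 0"
    unfolding invA qA by (simp add: A_def algebra_simps)
  moreover have "q * (\<epsilon> * (2 - A\<^sup>2)) > 0" using q(2) A(2) eps_pos by simp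
  ultimately show False by simp
qed

end

theorem theorem8:
  fixes \<epsilon> :: real and P :: inventory_problem
  assumes "\<epsilon> \<in> {0 <..< 1/2 * (sqrt 6 - 2)}"
    and "P = \<lparr>initial_level = 10 - \<epsilon>, discount = 1,
      stage1 = \<lparr>order_cost = 0, backorder_cost = 2, holding_cost = 2,
        demand_range = {1 - \<epsilon>..3 + \<epsilon>}, demand_mean = 2, demand_sd = 1\<rparr>,
      stage2 = \<lparr>order_cost = 0, backorder_cost = 1, holding_cost = 1,
        demand_range = {0..}, demand_mean = 8, demand_sd = 3\<rparr>\<rparr>"
  shows "(\<forall>x1 x2. (x1, x2) \<in> admissible P \<and> x1 = initial_level P \<and>
             (\<forall>d1\<ge>0. x2 d1 = initial_level P - d1 + \<epsilon>) \<longrightarrow> (x1, x2) \<in> optimal_policies P)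
    \<and> optimal_value P = ennreal (19 - 2 * \<epsilon>)
    \<and> base_stock P \<inter> optimal_policies P = {}"
proof -
  have P: "P = example_problem \<epsilon>" using assms(2) by (simp add: example_problem_def)
  have pos: "0 < \<epsilon>" using assms(1) by simp
  \<comment> \<open>Expanded and divided by 4, this is the polynomial form of the bound on
    \<open>\<epsilon>\<close>.\<close>
  have "(2 * \<epsilon> + 2)\<^sup>2 < (sqrt 6)\<^sup>2"
    using assms(1) by (intro power_strict_mono) auto
  then have small: "2 * \<epsilon> + \<epsilon>\<^sup>2 < 1 / 2" by (simp add: power2_sum power_mult_distrib)
  have "(x1, x2) \<in> optimal_policies P"
    if "(x1, x2) \<in> admissible P" "x1 = initial_level P" "\<forall>d1\<ge>0. x2 d1 = initial_level P - d1 + \<epsilon>"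
    for x1 x2
  proof -
    have x: "x1 = 10 - \<epsilon>" "\<And>d. d \<ge> 0 \<Longrightarrow> x2 d = 10 - d"
      using that by (auto simp: P example_problem_def)
    have "worst_case_cost P (x1, x2) \<le> ennreal (19 - 2 * \<epsilon>)"
      using worst_case_cost_le[OF pos small] that(1) x by (simp add: P)
    then show ?thesis
      using that(1) worst_case_cost_ge_optimum[OF pos small] optimal_value_example[OF pos small]
      by (auto simp: optimal_policies_def P intro: antisym)
  qed
  then show ?thesis
    using optimal_value_example[OF pos small] base_stock_not_optimal[OF pos small] by (auto simp: P)
qed

end
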